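(* Consider the fully composite problem $\varphi^*=\min_{x\in\operatorname{dom}\varphi}\{\varphi(x)=F(x,f(x))\}$ with subhomogeneous outer function (see context), where each component of $f$ is convex and continuously differentiable with Lipschitz continuous gradient, and $F(L_1(f))<+\infty$. Let $x_0\in\operatorname{dom}\varphi$ and assume that the initial level set is bounded: $$D_0=\sup_x\{\|x-x^*\|:\varphi(x)\le\varphi(x_0)\}<+\infty.$$ Let $\alpha\ge1$, $M=\alpha F(L_1(f))$, and let $\{x_k\}$ be generated by the Basic Gradient Method $$x_{k+1}\in\operatorname*{argmin}_{y\in\operatorname{dom}\varphi}\Big\{F\big(y,\ f(x_k)+\langle\nabla f(x_k),y-x_k\rangle\big)+\tfrac M2\|y-x_k\|^2\Big\},\qquad k\ge0$$ (minimizers are assumed to exist). Then for all $k\ge1$, $$\varphi(x_k)-\varphi^*\ \le\ \frac{4\alpha F(L_1(f))D_0^2}{k}.$$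
   Context: $\mathbb{E}$ is a finite-dimensional real vector space with norm $\|x\|=\langle Bx,x\rangle^{1/2}$, where $B:\mathbb{E}\to\mathbb{E}^*$ is self-adjoint positive definite, and dual norm $\|g\|_*=\langle g,B^{-1}g\rangle^{1/2}$. Fully composite problem: $F:\mathbb{E}\times\mathbb{R}^m\to\mathbb{R}\cup\{+\infty\}$ is closed and convex, and for every $x$ the function $F(x,\cdot)$ is monotone: $u\le v$ componentwise implies $F(x,u)\le F(x,v)$. $f=(f_1,\dots,f_m)^T:\operatorname{dom} f\to\mathbb{R}^m$ with $\operatorname{dom} f\subseteq\mathbb{E}$ open convex, and all $f_i$ closed and convex. $\varphi(x)=F(x,f(x))$, $\operatorname{dom}\varphi=\{x\in\operatorname{dom} f:F(x,f(x))<+\infty\}$ (with $\varphi=+\infty$ elsewhere), and a minimizer $x^*$ with $\varphi(x^* )=\varphi^*$ is assumed to exist. Subhomogeneity: for every $x\in\operatorname{dom}\varphi$, $F(x,\cdot)$ is finite on all of $\mathbb{R}^m$ and $F(x,u+tv)\le F(x,u)+tF(x,v)$ for all $u,v\in\mathbb{R}^m$, $t\ge0$. $\langle\nabla f(x),h\rangle$ denotes the vector $(\langle\nabla f_i(x),h\rangle)_{i=1}^m$. $L_1(f_i)<+\infty$ is a constant with $\|\nabla f_i(x)-\nabla f_i(y)\|_*\le L_1(f_i)\|x-y\|$ on $\operatorname{dom} f$; $L_1(f)=(L_1(f_1),\dots,L_1(f_m))^T$. Notation: $F(L_1(f))=\sup_{x\in\operatorname{dom}\varphi}F(x,L_1(f))$.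 *)

theory Defs
  imports "HOL-Analysis.Analysis"
begin

text \<open>
  The dual space \<open>\<bbbE>\<^sup>*\<close> is the type \<open>'a \<Rightarrow>\<^sub>L real\<close> of (automatically continuous) linear
  functionals, and the pairing of \<open>g\<close> with \<open>x\<close> is the application \<open>g x\<close>. The norms of \<open>\<bbbE>\<close> and
  \<open>\<bbbE>\<^sup>*\<close> are \<open>nrm B\<close> and \<open>dual_nrm B\<close> below; the built-in norm and inner product of the type
  \<open>'a\<close> only provide the (unique) vector space topology.
\<close>

definition pos_def_selfadjoint :: "('a::euclidean_space \<Rightarrow> 'a \<Rightarrow>\<^sub>L real) \<Rightarrow> bool" where
  "pos_def_selfadjoint B \<longleftrightarrow>
     linear B \<and> (\<forall>x y. B x y = B y x) \<and> (\<forall>x. x \<noteq> 0 \<longrightarrow> 0 < B x x)"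

definition nrm :: "('a::euclidean_space \<Rightarrow> 'a \<Rightarrow>\<^sub>L real) \<Rightarrow> 'a \<Rightarrow> real" where
  "nrm B x = sqrt (B x x)"

definition dual_nrm :: "('a::euclidean_space \<Rightarrow> 'a \<Rightarrow>\<^sub>L real) \<Rightarrow> ('a \<Rightarrow>\<^sub>L real) \<Rightarrow> real" where
  "dual_nrm B g = sqrt (g (inv B g))"

text \<open>
  A function into \<open>\<real> \<union> {+\<infinity>}\<close> is closed and convex if its epigraph is. The library's
  \<^const>\<open>convex_on\<close> and \<^const>\<open>epigraph\<close> are for real-valued functions only.
\<close>

definition epi :: "('b \<Rightarrow> ereal) \<Rightarrow> ('b \<times> real) set" where
  "epi h = {(z, t). h z \<le> ereal t}"

definition closed_convex_fun :: "('b::real_normed_vector \<Rightarrow> ereal) \<Rightarrow> bool" where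
  "closed_convex_fun h \<longleftrightarrow> (\<forall>z. h z \<noteq> -\<infinity>) \<and> closed (epi h) \<and> convex (epi h)"

definition phi ::
  "('a \<times> (real^'m) \<Rightarrow> ereal) \<Rightarrow> ('a \<Rightarrow> real^'m) \<Rightarrow> 'a set \<Rightarrow> 'a \<Rightarrow> ereal" where
  "phi F f Q x = (if x \<in> Q then F (x, f x) else \<infinity>)"

definition dom_phi ::
  "('a \<times> (real^'m) \<Rightarrow> ereal) \<Rightarrow> ('a \<Rightarrow> real^'m) \<Rightarrow> 'a set \<Rightarrow> 'a set" where
  "dom_phi F f Q = {x \<in> Q. F (x, f x) < \<infinity>}"

definition subhomogeneous_on :: "'a set \<Rightarrow> ('a \<times> (real^'m) \<Rightarrow> ereal) \<Rightarrow> bool" where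
  "subhomogeneous_on S F \<longleftrightarrow>
     (\<forall>x\<in>S. (\<forall>u. \<bar>F (x, u)\<bar> \<noteq> \<infinity>) \<and>
       (\<forall>u v. \<forall>t\<ge>0. F (x, u + t *\<^sub>R v) \<le> F (x, u) + ereal t * F (x, v)))"

text \<open>\<open>F(v) = sup {F(x, v) | x \<in> dom \<phi>}\<close>; for \<open>v = L\<^sub>1(f)\<close> this is \<open>F(L\<^sub>1(f))\<close>.\<close>

definition F_sup ::
  "('a \<times> (real^'m) \<Rightarrow> ereal) \<Rightarrow> ('a \<Rightarrow> real^'m) \<Rightarrow> 'a set \<Rightarrow> real^'m \<Rightarrow> ereal" where
  "F_sup F f Q v = (SUP x\<in>dom_phi F f Q. F (x, v))"

definition linearization ::
  "('a::euclidean_space \<Rightarrow> real^'m) \<Rightarrow> ('m \<Rightarrow> 'a \<Rightarrow> 'a \<Rightarrow>\<^sub>L real) \<Rightarrow> 'a \<Rightarrow> 'a \<Rightarrow> real^'m" where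
  "linearization f grad x y = f x + (\<chi> i. grad i x (y - x))"

definition bgm_objective ::
  "('a::euclidean_space \<Rightarrow> 'a \<Rightarrow>\<^sub>L real) \<Rightarrow> ('a \<times> (real^'m) \<Rightarrow> ereal) \<Rightarrow> ('a \<Rightarrow> real^'m) \<Rightarrow>
   ('m \<Rightarrow> 'a \<Rightarrow> 'a \<Rightarrow>\<^sub>L real) \<Rightarrow> ereal \<Rightarrow> 'a \<Rightarrow> 'a \<Rightarrow> ereal" where
  "bgm_objective B F f grad M x y =
     F (y, linearization f grad x y) + M / 2 * ereal ((nrm B (y - x))\<^sup>2)"

end

theory Submission
  imports Defs
begin

text \<open>
  Let \<open>M = \<alpha> F(L\<^sub>1(f))\<close>. Each step minimizes a model of \<open>\<phi>\<close> that is tight up to the proximal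
  term. From above: the linearization of \<open>f\<^sub>i\<close> at \<open>x\<close> errs at \<open>y\<close> by at most
  \<open>L\<^sub>1(f\<^sub>i) \<parallel>y - x\<parallel>\<^sup>2 / 2\<close>, and monotonicity together with subhomogeneity carries this vector
  error through \<open>F(y, \<cdot>)\<close> as at most \<open>F(L\<^sub>1(f)) \<parallel>y - x\<parallel>\<^sup>2 / 2\<close> (\<open>phi_le_linearized_model\<close>). From
  below: by convexity the linearization underestimates \<open>f\<close>, so monotonicity makes the linearized
  objective underestimate \<open>\<phi>\<close> (\<open>linearized_le_phi\<close>). Comparing the minimizer with an arbitrary
  \<open>y \<in> dom \<phi>\<close> gives
  \<open>\<phi>(x\<^sub>k\<^sub>+\<^sub>1) \<le> \<phi>(y) + M/2 \<parallel>y - x\<^sub>k\<parallel>\<^sup>2\<close>.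

  With \<open>y = x\<^sub>k\<close> this shows that the values decrease, hence \<open>\<parallel>x\<^sub>k - x\<^sup>*\<parallel> \<le> D\<^sub>0\<close>. With
  \<open>y = (1 - t) x\<^sub>k + t x\<^sup>*\<close> and the convexity of \<open>\<phi>\<close> (\<open>phi_convex\<close>) the gap
  \<open>\<delta>\<^sub>k = \<phi>(x\<^sub>k) - \<phi>\<^sup>*\<close> satisfies \<open>\<delta>\<^sub>k\<^sub>+\<^sub>1 \<le> (1 - t) \<delta>\<^sub>k + t\<^sup>2 M D\<^sub>0\<^sup>2 / 2\<close> for all \<open>t \<in> [0, 1]\<close>. This is the
  recursion of the conditional gradient method, and choosing \<open>t\<close> of order \<open>2 / k\<close> yields the
  sublinear rate (\<open>conditional_gradient_rate\<close>).
\<close>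

section \<open>The norms defined by a positive definite form\<close>

lemma pos_def_selfadjoint_nonneg:
  assumes "pos_def_selfadjoint B"
  shows "0 \<le> B x x"
  using assms unfolding pos_def_selfadjoint_def
  by (cases "x = 0") (auto simp: less_imp_le blinfun.zero_right)

lemma nrm_nonneg: "pos_def_selfadjoint B \<Longrightarrow> 0 \<le> nrm B x"
  by (simp add: nrm_def pos_def_selfadjoint_nonneg)

lemma nrm_pos: "pos_def_selfadjoint B \<Longrightarrow> x \<noteq> 0 \<Longrightarrow> 0 < nrm B x"
  by (simp add: nrm_def pos_def_selfadjoint_def)

lemma nrm_scaleR:
  assumes "pos_def_selfadjoint B"
  shows "nrm B (c *\<^sub>R x) = \<bar>c\<bar> * nrm B x"
proof -
  have "linear B" using assms by (simp add: pos_def_selfadjoint_def)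
  then have "B (c *\<^sub>R x) (c *\<^sub>R x) = c\<^sup>2 * B x x"
    by (simp add: linear_scale blinfun.scaleR_left blinfun.scaleR_right power2_eq_square)
  then show ?thesis by (simp add: nrm_def real_sqrt_mult)
qed

lemma nrm_minus_commute:
  assumes "pos_def_selfadjoint B"
  shows "nrm B (x - y) = nrm B (y - x)"
  using nrm_scaleR[OF assms, of "-1" "y - x"] by simp

lemma pos_def_selfadjoint_Cauchy_Schwarz:
  assumes B: "pos_def_selfadjoint B"
  shows "B x y \<le> nrm B x * nrm B y"
proof (cases "y = 0")
  case True
  then show ?thesis by (simp add: blinfun.zero_right nrm_def)
next
  case False
  have lin: "linear B" and sym: "B x y = B y x" and pos: "0 < B y y"
    using B False by (auto simp: pos_def_selfadjoint_def)
  define c where "c = B x y / B y y"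
  \<comment> \<open>\<open>x - c y\<close> is the part of \<open>x\<close> orthogonal to \<open>y\<close>.\<close>
  have "0 \<le> B (x - c *\<^sub>R y) (x - c *\<^sub>R y)"
    by (rule pos_def_selfadjoint_nonneg[OF B])
  also have "\<dots> = B x x - 2 * c * B x y + c * c * B y y"
    using sym
    by (simp add: linear_diff[OF lin] linear_scale[OF lin] blinfun.diff_left blinfun.diff_right
        blinfun.scaleR_left blinfun.scaleR_right algebra_simps)
  also have "\<dots> = B x x - (B x y)\<^sup>2 / B y y"
    using pos by (simp add: c_def field_simps power2_eq_square)
  finally have "(B x y)\<^sup>2 \<le> B x x * B y y"
    using pos by (simp add: field_simps)
  then show ?thesis
    unfolding nrm_def by (metis real_sqrt_mult real_le_rsqrt)
qed

text \<open>
  Since \<open>dual_nrm\<close> is written with \<open>inv B\<close>, it has its intended meaning only because \<open>B\<close> is onto: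
  in coordinates, \<open>B\<close> is an injective endomorphism of a finite-dimensional space.
\<close>

lemma pos_def_selfadjoint_surj:
  fixes B :: "'a::euclidean_space \<Rightarrow> 'a \<Rightarrow>\<^sub>L real"
  assumes B: "pos_def_selfadjoint B"
  shows "surj B"
proof -
  define T where "T = (\<lambda>x. \<Sum>b\<in>Basis. B x b *\<^sub>R b)"
  have lin: "linear B" using B by (simp add: pos_def_selfadjoint_def)
  have linT: "linear T"
    unfolding T_def
    by (intro linearI)
       (simp_all add: linear_add[OF lin] linear_scale[OF lin] blinfun.add_left blinfun.scaleR_left
          scaleR_add_left sum.distrib scaleR_sum_right)
  have T_inner: "T x \<bullet> b = B x b" if "b \<in> Basis" for x b
    using that by (simp add: T_def inner_sum_left inner_Basis if_distrib sum.delta' cong: if_cong)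
  have "inj T"
  proof (rule linear_injective_0[OF linT, THEN iffD2], intro allI impI)
    fix x assume "T x = 0"
    then have "B x = 0"
      using T_inner by (intro blinfun_euclidean_eqI) (metis inner_zero_left blinfun.zero_left)
    then have "B x x = 0" by (simp add: blinfun.zero_left)
    then show "x = 0" using B by (auto simp: pos_def_selfadjoint_def)
  qed
  then have "surj T" by (rule linear_inj_imp_surj[OF linT])
  show "surj B"
  proof (rule surjI)
    fix g :: "'a \<Rightarrow>\<^sub>L real"
    define v where "v = (\<Sum>b\<in>Basis. g b *\<^sub>R b)"
    have v: "v \<bullet> b = g b" if "b \<in> Basis" for b
      using that by (simp add: v_def inner_sum_left inner_Basis if_distrib sum.delta' cong: if_cong)
    show "B (inv T v) = g"
      using T_inner v surj_f_inv_f[OF \<open>surj T\<close>, of v]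
      by (intro blinfun_euclidean_eqI) metis
  qed
qed

lemma blinfun_le_dual_nrm:
  fixes B :: "'a::euclidean_space \<Rightarrow> 'a \<Rightarrow>\<^sub>L real"
    and g :: "'a \<Rightarrow>\<^sub>L real"
  assumes B: "pos_def_selfadjoint B"
  shows "g h \<le> dual_nrm B g * nrm B h"
proof -
  have "B (inv B g) = g" by (rule surj_f_inv_f[OF pos_def_selfadjoint_surj[OF B]])
  then show ?thesis
    using pos_def_selfadjoint_Cauchy_Schwarz[OF B, of "inv B g" h]
    by (simp add: dual_nrm_def nrm_def)
qed

lemma dual_nrm_nonneg:
  fixes B :: "'a::euclidean_space \<Rightarrow> 'a \<Rightarrow>\<^sub>L real"
    and g :: "'a \<Rightarrow>\<^sub>L real"
  assumes B: "pos_def_selfadjoint B"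
  shows "0 \<le> dual_nrm B g"
proof -
  have "B (inv B g) = g" by (rule surj_f_inv_f[OF pos_def_selfadjoint_surj[OF B]])
  then show ?thesis
    using pos_def_selfadjoint_nonneg[OF B, of "inv B g"] by (simp add: dual_nrm_def)
qed

text \<open>
  A Lipschitz constant of the gradient is nonnegative because an open nonempty domain has two
  distinct points; this makes \<open>F(x, L\<^sub>1(f))\<close> nonnegative, through
  \<open>F(x, L\<^sub>1(f)) \<ge> F(x, 0)\<close>.
\<close>

lemma Lipschitz_gradient_constant_nonneg:
  fixes B :: "'a::euclidean_space \<Rightarrow> 'a \<Rightarrow>\<^sub>L real"
    and G :: "'a \<Rightarrow> 'a \<Rightarrow>\<^sub>L real"
  assumes B: "pos_def_selfadjoint B" and "open Q" "Q \<noteq> {}"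
    and lip: "\<And>x y. x \<in> Q \<Longrightarrow> y \<in> Q \<Longrightarrow> dual_nrm B (G x - G y) \<le> L * nrm B (x - y)"
  shows "0 \<le> L"
proof -
  obtain x where x: "x \<in> Q" using \<open>Q \<noteq> {}\<close> by blast
  have "x islimpt Q"
    using \<open>open Q\<close> x by (metis interior_open interior_limit_point)
  then obtain y where y: "y \<in> Q" "y \<noteq> x" by (auto simp: islimpt_def)
  have "0 \<le> L * nrm B (x - y)"
    using dual_nrm_nonneg[OF B] lip[OF x y(1)] order_trans by blast
  moreover have "0 < nrm B (x - y)" using y by (intro nrm_pos[OF B]) simp
  ultimately show ?thesis by (simp add: zero_le_mult_iff)
qed

section \<open>First-order bounds for a smooth convex function\<close>

lemma has_derivative_along_line:
  fixes G :: "'a::real_normed_vector \<Rightarrow>\<^sub>L real"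
  assumes "(g has_derivative G) (at (x + t *\<^sub>R h))"
  shows "((\<lambda>t. g (x + t *\<^sub>R h)) has_real_derivative G h) (at t)"
proof -
  have "((\<lambda>t. x + t *\<^sub>R h) has_derivative (\<lambda>s. s *\<^sub>R h)) (at t)"
    by (auto intro!: derivative_eq_intros)
  from has_derivative_compose[OF this assms]
  have "((\<lambda>t. g (x + t *\<^sub>R h)) has_derivative (\<lambda>s. G h * s)) (at t)"
    by (simp add: blinfun.scaleR_right mult.commute)
  then show ?thesis by (rule has_derivative_imp_has_field_derivative) simp
qed

lemma convex_segment_mem:
  fixes x :: "'a::real_vector"
  assumes "convex Q" "x \<in> Q" "y \<in> Q" "0 \<le> t" "t \<le> (1::real)"
  shows "x + t *\<^sub>R (y - x) \<in> Q"
  using convexD_alt[OF assms] by (simp add: algebra_simps)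

text \<open>
  The difference of the two sides is monotone along the segment, because the slope of \<open>g\<close> at
  parameter \<open>t\<close> exceeds the initial slope by at most \<open>t L \<parallel>y - x\<parallel>\<^sup>2\<close>.
\<close>

lemma Lipschitz_gradient_quadratic_upper_bound:
  fixes B :: "'a::euclidean_space \<Rightarrow> 'a \<Rightarrow>\<^sub>L real"
    and G :: "'a \<Rightarrow> 'a \<Rightarrow>\<^sub>L real"
  assumes B: "pos_def_selfadjoint B" and "convex Q"
    and deriv: "\<And>x. x \<in> Q \<Longrightarrow> (g has_derivative G x) (at x)"
    and lip: "\<And>x y. x \<in> Q \<Longrightarrow> y \<in> Q \<Longrightarrow> dual_nrm B (G x - G y) \<le> L * nrm B (x - y)"
    and x: "x \<in> Q" and y: "y \<in> Q"
  shows "g y \<le> g x + G x (y - x) + L / 2 * (nrm B (y - x))\<^sup>2"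
proof -
  define h where "h = y - x"
  define n where "n = nrm B h"
  have seg: "x + t *\<^sub>R h \<in> Q" if "0 \<le> t" "t \<le> 1" for t
    using convex_segment_mem[OF \<open>convex Q\<close> x y that] by (simp add: h_def)
  have "g (x + 1 *\<^sub>R h) - 1 * G x h - L / 2 * 1\<^sup>2 * n\<^sup>2
      \<le> g (x + 0 *\<^sub>R h) - 0 * G x h - L / 2 * 0\<^sup>2 * n\<^sup>2"
  proof (rule DERIV_nonpos_imp_nonincreasing[of 0 1])
    fix t :: real assume t: "0 \<le> t" "t \<le> 1"
    have "((\<lambda>t. g (x + t *\<^sub>R h) - t * G x h - L / 2 * t\<^sup>2 * n\<^sup>2) has_real_derivative
        G (x + t *\<^sub>R h) h - G x h - L * t * n\<^sup>2) (at t)"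
      by (rule derivative_eq_intros has_derivative_along_line deriv[OF seg[OF t]] refl | simp)+
    moreover have "G (x + t *\<^sub>R h) h - G x h - L * t * n\<^sup>2 \<le> 0"
    proof -
      have "G (x + t *\<^sub>R h) h - G x h = (G (x + t *\<^sub>R h) - G x) h"
        by (simp add: blinfun.diff_left)
      also have "\<dots> \<le> dual_nrm B (G (x + t *\<^sub>R h) - G x) * n"
        unfolding n_def by (rule blinfun_le_dual_nrm[OF B])
      also have "\<dots> \<le> (L * nrm B (x + t *\<^sub>R h - x)) * n"
        by (rule mult_right_mono[OF lip[OF seg[OF t] x]]) (simp add: n_def nrm_nonneg[OF B])
      also have "\<dots> = L * t * n\<^sup>2"
        using t by (simp add: nrm_scaleR[OF B] n_def power2_eq_square)
      finally show ?thesis by simp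
    qed
    ultimately show "\<exists>d. ((\<lambda>t. g (x + t *\<^sub>R h) - t * G x h - L / 2 * t\<^sup>2 * n\<^sup>2)
        has_real_derivative d) (at t) \<and> d \<le> 0"
      by blast
  qed simp
  then show ?thesis by (simp add: h_def n_def)
qed

lemma convex_on_above_tangent:
  fixes G :: "'a::real_normed_vector \<Rightarrow>\<^sub>L real"
  assumes conv: "convex_on Q g" and "open Q" and x: "x \<in> Q" and y: "y \<in> Q"
    and deriv: "(g has_derivative G) (at x)"
  shows "g x + G (y - x) \<le> g y"
proof -
  define A where "A = {t::real. x + t *\<^sub>R (y - x) \<in> Q}"
  have aff: "x + ((1 - u) * s + u * t) *\<^sub>R (y - x)
      = (1 - u) *\<^sub>R (x + s *\<^sub>R (y - x)) + u *\<^sub>R (x + t *\<^sub>R (y - x))" for u s t :: real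
    by (simp add: algebra_simps)
  have "convex Q" using conv by (rule convex_on_imp_convex)
  have convA: "convex_on A (\<lambda>t. g (x + t *\<^sub>R (y - x)))"
  proof (rule convex_onI)
    show "convex A"
      unfolding convex_alt A_def
      using aff convexD_alt[OF \<open>convex Q\<close>] by (simp del: scaleR_left.add)
    fix u s t :: real assume "0 < u" "u < 1" "s \<in> A" "t \<in> A"
    then show "g (x + ((1 - u) *\<^sub>R s + u *\<^sub>R t) *\<^sub>R (y - x))
        \<le> (1 - u) * g (x + s *\<^sub>R (y - x)) + u * g (x + t *\<^sub>R (y - x))"
      using convex_onD[OF conv, of u "x + s *\<^sub>R (y - x)" "x + t *\<^sub>R (y - x)"]
      by (simp add: A_def aff)
  qed
  have "open A"
  proof -
    have "continuous_on UNIV (\<lambda>t. x + t *\<^sub>R (y - x))" by (intro continuous_intros)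
    then have "open ((\<lambda>t. x + t *\<^sub>R (y - x)) -` Q)" using \<open>open Q\<close> by (rule open_vimage[rotated])
    then show ?thesis by (simp add: A_def vimage_def)
  qed
  have "G (y - x) * (1 - 0) \<le> g (x + 1 *\<^sub>R (y - x)) - g (x + 0 *\<^sub>R (y - x))"
  proof (rule convex_on_imp_above_tangent[OF convA])
    show "connected A" using convA convex_on_imp_convex convex_connected by blast
    show "0 \<in> interior A" using \<open>open A\<close> x by (simp add: interior_open A_def)
    show "1 \<in> A" using y by (simp add: A_def)
    show "((\<lambda>t. g (x + t *\<^sub>R (y - x))) has_real_derivative G (y - x)) (at 0 within A)"
      using has_derivative_along_line[of g G x 0 "y - x"] deriv
      by (simp add: has_field_derivative_at_within)
  qed
  then show ?thesis by simp
qed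

section \<open>Convexity of the composite objective\<close>

lemma closed_convex_fun_convexD:
  assumes "closed_convex_fun h" and "0 \<le> t" "t \<le> 1"
    and "h z \<le> ereal a" and "h w \<le> ereal b"
  shows "h ((1 - t) *\<^sub>R z + t *\<^sub>R w) \<le> ereal ((1 - t) * a + t * b)"
proof -
  have "convex (epi h)" using assms by (simp add: closed_convex_fun_def)
  from convexD_alt[OF this, of "(z, a)" "(w, b)" t] assms
  show ?thesis by (simp add: epi_def)
qed

lemma phi_convex:
  fixes F :: "'a::real_normed_vector \<times> (real^'m) \<Rightarrow> ereal"
  assumes F: "closed_convex_fun F"
    and mono: "\<And>x u v. u \<le> v \<Longrightarrow> F (x, u) \<le> F (x, v)"
    and conv: "\<And>i. convex_on Q (\<lambda>x. f x $ i)"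
    and "convex Q" and x: "x \<in> Q" "F (x, f x) \<le> ereal a" and y: "y \<in> Q" "F (y, f y) \<le> ereal b"
    and t: "0 \<le> t" "t \<le> 1"
  defines "z \<equiv> (1 - t) *\<^sub>R x + t *\<^sub>R y"
  shows "z \<in> Q" and "F (z, f z) \<le> ereal ((1 - t) * a + t * b)"
proof -
  show "z \<in> Q" unfolding z_def by (rule convexD_alt[OF \<open>convex Q\<close> x(1) y(1) t])
  have "f z \<le> (1 - t) *\<^sub>R f x + t *\<^sub>R f y"
    unfolding less_eq_vec_def z_def
    using convex_onD[OF conv t x(1) y(1)] by simp
  then have "F (z, f z) \<le> F (z, (1 - t) *\<^sub>R f x + t *\<^sub>R f y)" by (rule mono)
  also have "\<dots> = F ((1 - t) *\<^sub>R (x, f x) + t *\<^sub>R (y, f y))" by (simp add: z_def)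
  also have "\<dots> \<le> ereal ((1 - t) * a + t * b)"
    by (rule closed_convex_fun_convexD[OF F t x(2) y(2)])
  finally show "F (z, f z) \<le> ereal ((1 - t) * a + t * b)" .
qed

section \<open>The rate implied by a one-step inequality\<close>

text \<open>
  With \<open>t = 2 / (k + 1)\<close> the factor \<open>1 - t\<close> contracts \<open>4 C / k\<close> below \<open>4 C / (k + 1)\<close>, by a
  margin that absorbs the quadratic term; the first step uses \<open>t = 1\<close>, which forgets \<open>\<delta> 0\<close>.
\<close>

lemma conditional_gradient_rate:
  fixes \<delta> :: "nat \<Rightarrow> real"
  assumes step: "\<And>k t. 0 \<le> t \<Longrightarrow> t \<le> 1 \<Longrightarrow> \<delta> (Suc k) \<le> (1 - t) * \<delta> k + t\<^sup>2 * C / 2"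
    and "0 \<le> C" and "k \<ge> 1"
  shows "\<delta> k \<le> 4 * C / real k"
  using \<open>k \<ge> 1\<close>
proof (induction k rule: dec_induct)
  case base
  show ?case using step[of 1 0] \<open>0 \<le> C\<close> by simp
next
  case (step k)
  define n where "n = real k"
  have n: "1 \<le> n" using step.hyps by (simp add: n_def)
  define t where "t = 2 / (n + 1)"
  have t: "0 \<le> t" "t \<le> 1" using n by (auto simp: t_def field_simps)
  have "\<delta> (Suc k) \<le> (1 - t) * \<delta> k + t\<^sup>2 * C / 2" by (rule assms(1)[OF t])
  also have "\<dots> \<le> (1 - t) * (4 * C / n) + t\<^sup>2 * C / 2"
    using mult_left_mono[OF step.IH, of "1 - t"] t by (simp add: n_def)
  also have "\<dots> = 4 * C / (n + 1) - C * (2 * n + 4) / (n * (n + 1)\<^sup>2)"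
  proof -
    have "n \<noteq> 0" "n + 1 \<noteq> 0" using n by auto
    then show ?thesis unfolding t_def by (simp add: divide_simps) algebra
  qed
  also have "\<dots> \<le> 4 * C / (n + 1)" using n \<open>0 \<le> C\<close> by simp
  finally show ?case by (simp add: n_def add.commute)
qed

section \<open>The Basic Gradient Method\<close>

text \<open>
  The point of subhomogeneity: the componentwise error \<open>(\<parallel>y - x\<parallel>\<^sup>2 / 2) L\<close> of the linearization
  leaves \<open>F(y, \<cdot>)\<close> as an additive term, controlled uniformly in \<open>y\<close> by \<open>F_sup\<close>.
\<close>

lemma phi_le_linearized_model:
  fixes B :: "'a::euclidean_space \<Rightarrow> 'a \<Rightarrow>\<^sub>L real"
    and F :: "'a \<times> (real^'m) \<Rightarrow> ereal"
    and grad :: "'m \<Rightarrow> 'a \<Rightarrow> 'a \<Rightarrow>\<^sub>L real"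
  assumes B: "pos_def_selfadjoint B"
    and mono: "\<And>x u v. u \<le> v \<Longrightarrow> F (x, u) \<le> F (x, v)"
    and "convex Q"
    and deriv: "\<And>i x. x \<in> Q \<Longrightarrow> ((\<lambda>x. f x $ i) has_derivative grad i x) (at x)"
    and lip: "\<And>i x y. x \<in> Q \<Longrightarrow> y \<in> Q \<Longrightarrow> dual_nrm B (grad i x - grad i y) \<le> L $ i * nrm B (x - y)"
    and subhom: "subhomogeneous_on (dom_phi F f Q) F"
    and x: "x \<in> Q" and y: "y \<in> dom_phi F f Q"
  shows "F (y, f y) \<le> F (y, linearization f grad x y) + ereal ((nrm B (y - x))\<^sup>2 / 2) * F_sup F f Q L"
proof -
  define r where "r = (nrm B (y - x))\<^sup>2 / 2"
  have "y \<in> Q" using y by (simp add: dom_phi_def)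
  then have "f y $ i \<le> f x $ i + grad i x (y - x) + L $ i / 2 * (nrm B (y - x))\<^sup>2" for i
    by (intro Lipschitz_gradient_quadratic_upper_bound[OF B \<open>convex Q\<close> deriv lip x])
  then have "f y \<le> linearization f grad x y + r *\<^sub>R L"
    by (simp add: less_eq_vec_def linearization_def r_def mult.commute)
  then have "F (y, f y) \<le> F (y, linearization f grad x y + r *\<^sub>R L)" by (rule mono)
  also have "\<dots> \<le> F (y, linearization f grad x y) + ereal r * F (y, L)"
    using subhom y by (simp add: subhomogeneous_on_def r_def)
  also have "\<dots> \<le> F (y, linearization f grad x y) + ereal r * F_sup F f Q L"
    unfolding F_sup_def using y
    by (intro add_left_mono ereal_mult_left_mono SUP_upper) (auto simp: r_def)
  finally show ?thesis by (simp add: r_def)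
qed

lemma linearized_le_phi:
  fixes F :: "'a::euclidean_space \<times> (real^'m) \<Rightarrow> ereal"
    and grad :: "'m \<Rightarrow> 'a \<Rightarrow> 'a \<Rightarrow>\<^sub>L real"
  assumes mono: "\<And>x u v. u \<le> v \<Longrightarrow> F (x, u) \<le> F (x, v)"
    and conv: "\<And>i. convex_on Q (\<lambda>x. f x $ i)"
    and "open Q"
    and deriv: "\<And>i x. x \<in> Q \<Longrightarrow> ((\<lambda>x. f x $ i) has_derivative grad i x) (at x)"
    and x: "x \<in> Q" and y: "y \<in> Q"
  shows "F (y, linearization f grad x y) \<le> F (y, f y)"
proof (rule mono)
  show "linearization f grad x y \<le> f y"
    unfolding less_eq_vec_def linearization_def
    using convex_on_above_tangent[OF conv \<open>open Q\<close> x y deriv[OF x]] by simp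
qed

lemma F_sup_nonneg:
  assumes mono: "\<And>x u v. u \<le> v \<Longrightarrow> F (x, u) \<le> F (x, v)"
    and subhom: "subhomogeneous_on (dom_phi F f Q) F"
    and "0 \<le> v" and x: "x \<in> dom_phi F f Q"
  shows "0 \<le> F_sup F f Q v"
proof -
  have fin: "\<bar>F (x, 0)\<bar> \<noteq> \<infinity>" using subhom x by (simp add: subhomogeneous_on_def)
  \<comment> \<open>Subhomogeneity with \<open>u = v = 0\<close> and \<open>t = 1\<close> excludes a negative value at \<open>0\<close>.\<close>
  have "F (x, 0 + 1 *\<^sub>R 0) \<le> F (x, 0) + ereal 1 * F (x, 0)"
    using subhom x unfolding subhomogeneous_on_def by (meson zero_le_one)
  then have "0 \<le> F (x, 0)" using fin by (cases "F (x, 0)") auto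
  also have "\<dots> \<le> F (x, v)" using \<open>0 \<le> v\<close> by (rule mono)
  also have "\<dots> \<le> F_sup F f Q v" unfolding F_sup_def using x by (rule SUP_upper)
  finally show ?thesis .
qed


theorem theorem6:
  fixes B :: "'a::euclidean_space \<Rightarrow> 'a \<Rightarrow>\<^sub>L real"
    and F :: "'a \<times> (real^'m) \<Rightarrow> ereal"
    and f :: "'a \<Rightarrow> real^'m"
    and Q :: "'a set"
    and grad :: "'m \<Rightarrow> 'a \<Rightarrow> 'a \<Rightarrow>\<^sub>L real"
    and L\<^sub>1 :: "real^'m"
    and xs :: 'a and x :: "nat \<Rightarrow> 'a"
    and \<alpha> :: real and M D\<^sub>0 :: ereal
  assumes B: "pos_def_selfadjoint B"
    and F_closed_convex: "closed_convex_fun F"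
    and F_mono: "\<And>x u v. u \<le> v \<Longrightarrow> F (x, u) \<le> F (x, v)"
    and Q: "open Q" "convex Q"
    and f_convex: "\<And>i. convex_on Q (\<lambda>x. f x $ i)"
    and f_closed: "\<And>i. closed (epigraph Q (\<lambda>x. f x $ i))"
    and f_diff: "\<And>i x. x \<in> Q \<Longrightarrow> ((\<lambda>x. f x $ i) has_derivative grad i x) (at x)"
    and f_C1: "\<And>i. continuous_on Q (grad i)"
    and f_lipschitz:
      "\<And>i x y. x \<in> Q \<Longrightarrow> y \<in> Q \<Longrightarrow> dual_nrm B (grad i x - grad i y) \<le> L\<^sub>1 $ i * nrm B (x - y)"
    and subhom: "subhomogeneous_on (dom_phi F f Q) F"
    and FL_finite: "F_sup F f Q L\<^sub>1 < \<infinity>"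
    and minimizer: "is_arg_min (phi F f Q) (\<lambda>y. y \<in> dom_phi F f Q) xs"
    and x0: "x 0 \<in> dom_phi F f Q"
    and D0: "D\<^sub>0 = (SUP y\<in>{y. phi F f Q y \<le> phi F f Q (x 0)}. ereal (nrm B (y - xs)))"
    and D0_finite: "D\<^sub>0 < \<infinity>"
    and \<alpha>: "\<alpha> \<ge> 1"
    and M: "M = ereal \<alpha> * F_sup F f Q L\<^sub>1"
    and step: "\<And>k. is_arg_min (bgm_objective B F f grad M (x k)) (\<lambda>y. y \<in> dom_phi F f Q) (x (Suc k))"
  shows "\<forall>k\<ge>1. phi F f Q (x k) - phi F f Q xs
                 \<le> 4 * ereal \<alpha> * F_sup F f Q L\<^sub>1 * D\<^sub>0\<^sup>2 / ereal (real k)"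
proof -
  let ?S = "dom_phi F f Q"
  have S: "y \<in> Q" "phi F f Q y = F (y, f y)" if "y \<in> ?S" for y
    using that by (auto simp: dom_phi_def phi_def)
  have fin: "\<bar>F (y, u)\<bar> \<noteq> \<infinity>" if "y \<in> ?S" for y u
    using subhom that by (simp add: subhomogeneous_on_def)
  have xs_S: "xs \<in> ?S"
    using minimizer by (simp add: is_arg_min_def)
  have xS: "x k \<in> ?S" for k
    using x0 step[of "k - 1"] by (cases k) (auto simp: is_arg_min_def)

  have "0 \<le> L\<^sub>1 $ i" for i
    using Lipschitz_gradient_constant_nonneg[OF B Q(1) _ f_lipschitz] S(1)[OF x0] by blast
  then have "0 \<le> L\<^sub>1" by (simp add: less_eq_vec_def)
  then have "0 \<le> F_sup F f Q L\<^sub>1" by (intro F_sup_nonneg[OF F_mono subhom _ x0])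
  then obtain l where l: "F_sup F f Q L\<^sub>1 = ereal l" "0 \<le> l"
    using FL_finite by (cases "F_sup F f Q L\<^sub>1") auto
  define m where "m = \<alpha> * l"
  have m: "M = ereal m" "0 \<le> m" "l \<le> m"
    using M l \<alpha> mult_right_mono[of 1 \<alpha> l] by (auto simp: m_def)

  define p where "p y = real_of_ereal (phi F f Q y)" for y
  have p: "F (y, f y) = ereal (p y)" if "y \<in> ?S" for y
    using fin[OF that] S(2)[OF that] by (simp add: p_def ereal_real)

  \<comment> \<open>The model bounds \<open>\<phi>\<close> from above at the new iterate, and exceeds \<open>\<phi>\<close> by at most the
    proximal term at any competitor \<open>y\<close>.\<close>
  have descent: "p (x (Suc k)) \<le> p y + m / 2 * (nrm B (y - x k))\<^sup>2" if y: "y \<in> ?S" for k y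
  proof -
    let ?y = "x (Suc k)" and ?obj = "bgm_objective B F f grad M (x k)"
    let ?r = "(nrm B (?y - x k))\<^sup>2 / 2"
    have "ereal (p ?y) \<le> F (?y, linearization f grad (x k) ?y) + ereal ?r * F_sup F f Q L\<^sub>1"
      using phi_le_linearized_model[OF B F_mono Q(2) f_diff f_lipschitz subhom S(1)[OF xS] xS]
      by (simp add: p[OF xS])
    also have "\<dots> \<le> F (?y, linearization f grad (x k) ?y) + ereal (m * ?r)"
      using m by (intro add_left_mono) (simp add: l mult.commute mult_right_mono)
    also have "\<dots> = ?obj ?y" by (simp add: bgm_objective_def m)
    also have "\<dots> \<le> ?obj y"
      using step[of k] y by (auto simp: is_arg_min_def not_less)
    also have "\<dots> \<le> ereal (p y) + ereal (m / 2 * (nrm B (y - x k))\<^sup>2)"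
      using linearized_le_phi[of F, OF F_mono f_convex Q(1) f_diff S(1)[OF xS[of k]] S(1)[OF y]]
      unfolding bgm_objective_def by (simp add: m p[OF y] add_right_mono del: plus_ereal.simps)
    finally show ?thesis by simp
  qed

  \<comment> \<open>The iterates never leave the initial level set, so \<open>D\<^sub>0\<close> bounds their distance to \<open>x\<^sup>*\<close>.\<close>
  have "p (x (Suc k)) \<le> p (x k)" for k
    using descent[OF xS, of k k] by (simp add: nrm_def blinfun.zero_right)
  then have p_le: "p (x k) \<le> p (x 0)" for k
    by (induction k) (auto intro: order_trans)
  have bound: "ereal (nrm B (y - xs)) \<le> D\<^sub>0" if "y \<in> ?S" "p y \<le> p (x 0)" for y
    unfolding D0 using that by (intro SUP_upper) (simp add: S(2) p xS)
  have "0 \<le> D\<^sub>0"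
    using bound[OF x0] nrm_nonneg[OF B, of "x 0 - xs"] by (simp add: order_trans[rotated])
  then obtain d where d: "D\<^sub>0 = ereal d" "0 \<le> d"
    using D0_finite by (cases D\<^sub>0) auto
  have dist: "nrm B (xs - x k) \<le> d" for k
    using bound[OF xS p_le, of k] by (simp add: d nrm_minus_commute[OF B])

  define \<delta> where "\<delta> k = p (x k) - p xs" for k
  have recursion: "\<delta> (Suc k) \<le> (1 - t) * \<delta> k + t\<^sup>2 * (m * d\<^sup>2) / 2"
    if t: "0 \<le> t" "t \<le> 1" for k t
  proof -
    define z where "z = (1 - t) *\<^sub>R x k + t *\<^sub>R xs"
    have zQ: "z \<in> Q" and pz: "F (z, f z) \<le> ereal ((1 - t) * p (x k) + t * p xs)"
      unfolding z_def
      using phi_convex[of F, OF F_closed_convex F_mono f_convex Q(2)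
          S(1)[OF xS[of k]] eq_refl[OF p[OF xS]] S(1)[OF xs_S] eq_refl[OF p[OF xs_S]] t]
      by simp_all
    have z: "z \<in> ?S" using zQ pz by (auto simp: dom_phi_def)
    have "z - x k = t *\<^sub>R (xs - x k)" by (simp add: z_def algebra_simps)
    then have "(nrm B (z - x k))\<^sup>2 \<le> t\<^sup>2 * d\<^sup>2"
      using dist[of k] nrm_nonneg[OF B, of "xs - x k"]
      by (simp add: nrm_scaleR[OF B] power_mult_distrib mult_left_mono power_mono)
    then have "m / 2 * (nrm B (z - x k))\<^sup>2 \<le> m / 2 * (t\<^sup>2 * d\<^sup>2)"
      using m(2) by (intro mult_left_mono) auto
    then have "p (x (Suc k)) \<le> (1 - t) * p (x k) + t * p xs + m / 2 * (t\<^sup>2 * d\<^sup>2)"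
      using descent[OF z, of k] pz by (simp add: p[OF z])
    then show ?thesis by (simp add: \<delta>_def algebra_simps)
  qed

  show ?thesis
  proof (intro allI impI)
    fix k :: nat assume "1 \<le> k"
    then have "\<delta> k \<le> 4 * (m * d\<^sup>2) / real k"
      using conditional_gradient_rate[of \<delta> "m * d\<^sup>2" k, OF recursion] m(2) by simp
    then show "phi F f Q (x k) - phi F f Q xs
        \<le> 4 * ereal \<alpha> * F_sup F f Q L\<^sub>1 * D\<^sub>0\<^sup>2 / ereal (real k)"
      using \<open>1 \<le> k\<close>
      by (simp add: S(2)[OF xS] S(2)[OF xs_S] p[OF xS] p[OF xs_S] l d \<delta>_def m_def mult.assoc)
  qed
qed

end
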